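(* Let $\kappa$ be an infinite cardinal and $D$ a tournament with $|V(D)|=\kappa$, $V=V(D)$. Then $V$ can be partitioned into pieces $\{V_x: x\in\Gamma\}$, where $(\Gamma,\vartriangleleft)$ is a linear order, such that (1) for each $x\in\Gamma$, $D\upharpoonright V_x$ is $\kappa$-uniform, i.e. $|(N^+(v)\,\Delta\, N^+(v'))\cap V_x|<\kappa$ and $|(N^-(v)\,\Delta\, N^-(v'))\cap V_x|<\kappa$ for all $v,v'\in V_x$; and (2) every arc $uv$ of $D$ with $u\in V_y$, $v\in V_x$ and $x\vartriangleleft y$ is $\kappa$-reversible in $D$.
   Context: A tournament is a digraph (no loops) in which for all distinct $u,v$ exactly one of $uv$, $vu$ is an arc. $N^+(v)$ and $N^-(v)$ denote the out- and in-neighbourhoods of $v$ in $D$, $\Delta$ denotes symmetric difference, and $D\upharpoonright A$ is the induced subdigraph on $A$. An arc $uv$ of $D$ is $\kappa$-reversible if there are $\kappa$ many pairwise edge-disjoint directed paths from $v$ to $u$ in $D$. *)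

theory Defs
  imports
    "Graph_Theory.Pair_Digraph"
    "Graph_Theory.Digraph_Component"
    "HOL-Library.Disjoint_Sets"
begin

unbundle cardinal_syntax

locale tournament = pair_loopfree_digraph D for D :: "'a pair_pre_digraph" +
  assumes exactly_one_arc:
    "\<lbrakk>u \<in> pverts D; v \<in> pverts D; u \<noteq> v\<rbrakk> \<Longrightarrow> ((u, v) \<in> parcs D) \<noteq> ((v, u) \<in> parcs D)"

definition out_nbhd :: "('a, 'b) pre_digraph \<Rightarrow> 'a \<Rightarrow> 'a set" where
  "out_nbhd D v = {w. v \<rightarrow>\<^bsub>D\<^esub> w}"

definition in_nbhd :: "('a, 'b) pre_digraph \<Rightarrow> 'a \<Rightarrow> 'a set" where
  "in_nbhd D v = {w. w \<rightarrow>\<^bsub>D\<^esub> v}"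

text \<open>Cardinals are represented, as in the library, by cardinal orders \<open>\<kappa>\<close> over an arbitrary type.
  \<open>uniform_on \<kappa> D A\<close> says that the subdigraph of \<open>D\<close> induced by \<open>A\<close> is \<open>\<kappa>\<close>-uniform; the
  neighbourhoods are taken in \<open>D\<close> and then cut down to \<open>A\<close>.\<close>

definition uniform_on :: "'k rel \<Rightarrow> ('a, 'b) pre_digraph \<Rightarrow> 'a set \<Rightarrow> bool" where
  "uniform_on \<kappa> D A \<longleftrightarrow> (\<forall>v\<in>A. \<forall>v'\<in>A.
     |sym_diff (out_nbhd D v) (out_nbhd D v') \<inter> A| <o \<kappa> \<and>
     |sym_diff (in_nbhd D v) (in_nbhd D v') \<inter> A| <o \<kappa>)"

lemma nbhd_induce_subgraph:
  assumes "v \<in> A"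
  shows "out_nbhd (D \<restriction> A) v = out_nbhd D v \<inter> A"
    and "in_nbhd (D \<restriction> A) v = in_nbhd D v \<inter> A"
  using assms
  by (auto simp: out_nbhd_def in_nbhd_def induce_subgraph_def arcs_ends_def arc_to_ends_def)

lemma uniform_on_iff_induce_subgraph:
  fixes A :: "'a set"
  shows "uniform_on \<kappa> D A \<longleftrightarrow> uniform_on \<kappa> (D \<restriction> A) A"
proof -
  have "sym_diff (X \<inter> A) (Y \<inter> A) \<inter> A = sym_diff X Y \<inter> A" for X Y :: "'a set"
    by blast
  then show ?thesis
    unfolding uniform_on_def by (simp add: nbhd_induce_subgraph cong: ball_cong)
qed

text \<open>A path is given by its list of arcs, so paths are edge-disjoint iff the sets of entries of
  these lists are disjoint.\<close>

definition reversible :: "'k rel \<Rightarrow> ('a, 'b) pre_digraph \<Rightarrow> 'a \<Rightarrow> 'a \<Rightarrow> bool" where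
  "reversible \<kappa> D u v \<longleftrightarrow> (\<exists>P. |P| =o \<kappa> \<and> (\<forall>p\<in>P. pre_digraph.apath D v p u) \<and>
     pairwise (\<lambda>p q. set p \<inter> set q = {}) P)"

end

theory Submission
  imports Defs
begin

text \<open>
  Let \<open>H\<close> consist of the arcs of \<open>D\<close> that are not \<open>\<kappa>\<close>-reversible. The pieces are the strong components
  of \<open>H\<close>, and \<open>\<Gamma>\<close> is a topological order of them, so that no backward arc of \<open>D\<close> belongs to \<open>H\<close>.
  If \<open>uv\<close> is an arc of \<open>H\<close>, then fewer than \<open>\<kappa>\<close> vertices lie on a path of length two from \<open>v\<close> to \<open>u\<close>,
  so in a tournament \<open>N\<^sup>-(u)\<close> is contained in \<open>N\<^sup>-(v)\<close> up to fewer than \<open>\<kappa>\<close> vertices. This almost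
  inclusion is transitive, hence it holds whenever \<open>v\<close> is reachable from \<open>u\<close> in \<open>H\<close>, and mutual almost
  inclusion makes every strong component \<open>\<kappa>\<close>-uniform.
\<close>

section \<open>Linear extensions of partial orders\<close>

lemma partial_order_on_insert_pair:
  assumes "partial_order_on A r" and "a \<in> A" "b \<in> A" and "(b, a) \<notin> r"
  shows "partial_order_on A (r \<union> {(x, y). (x, a) \<in> r \<and> (b, y) \<in> r})"
    (is "partial_order_on A ?s")
proof -
  have trans_r: "(x, z) \<in> r" if "(x, y) \<in> r" "(y, z) \<in> r" for x y z
    using assms(1) that by (meson partial_order_onD(2) transD)
  have antisym_r: "x = y" if "(x, y) \<in> r" "(y, x) \<in> r" for x y
    using assms(1) that by (meson partial_order_onD(3) antisymD)
  have "?s \<subseteq> A \<times> A" and "refl_on A ?s"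
    using assms(1) by (auto simp: order_on_defs refl_on_def)
  moreover have "trans ?s"
    by (rule transI) (auto intro: trans_r)
  moreover have "antisym ?s"
  proof (rule antisymI)
    fix x y assume "(x, y) \<in> ?s" "(y, x) \<in> ?s"
    moreover have "(b, z) \<notin> r \<or> (z, a) \<notin> r" for z
      using assms(4) trans_r by blast
    ultimately show "x = y"
      using trans_r antisym_r by auto
  qed
  ultimately show ?thesis
    by (simp add: order_on_defs)
qed

lemma partial_order_on_Union_chain:
  assumes "C \<noteq> {}" and "chain\<^sub>\<subseteq> C" and "\<And>r. r \<in> C \<Longrightarrow> partial_order_on A r"
  shows "partial_order_on A (\<Union>C)"
proof -
  have "\<Union>C \<subseteq> A \<times> A" and "refl_on A (\<Union>C)"
    using assms(1,3) by (fastforce simp: order_on_defs refl_on_def)+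
  moreover have "trans (\<Union>C)"
    using assms(2,3) by (intro chain_subset_trans_Union) (auto simp: order_on_defs)
  moreover have "antisym (\<Union>C)"
    using assms(2,3) by (intro chain_subset_antisym_Union) (auto simp: order_on_defs)
  ultimately show ?thesis
    by (simp add: order_on_defs)
qed

lemma linear_order_on_if_maximal_partial_order_on:
  assumes "partial_order_on A r"
    and maximal: "\<And>s. partial_order_on A s \<Longrightarrow> r \<subseteq> s \<Longrightarrow> s = r"
  shows "linear_order_on A r"
proof -
  have "(a, b) \<in> r \<or> (b, a) \<in> r" if "a \<in> A" "b \<in> A" for a b
  proof (rule ccontr)
    assume incomparable: "\<not> ((a, b) \<in> r \<or> (b, a) \<in> r)"
    have "r \<union> {(x, y). (x, a) \<in> r \<and> (b, y) \<in> r} = r"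
      using assms(1) that incomparable by (intro maximal partial_order_on_insert_pair) auto
    moreover have "(a, a) \<in> r" "(b, b) \<in> r"
      using assms(1) that by (auto simp: order_on_defs refl_on_def)
    ultimately show False
      using incomparable by blast
  qed
  then show ?thesis
    using assms(1) by (simp add: linear_order_on_def total_on_def)
qed

theorem szpilrajn:
  assumes "partial_order_on A p"
  obtains r where "linear_order_on A r" "p \<subseteq> r"
proof -
  let ?extensions = "{r. partial_order_on A r \<and> p \<subseteq> r}"
  have "\<exists>r\<in>?extensions. \<forall>s\<in>?extensions. r \<subseteq> s \<longrightarrow> s = r"
  proof (rule subset_Zorn_nonempty)
    show "?extensions \<noteq> {}"
      using assms by blast
    show "\<Union>C \<in> ?extensions" if "C \<noteq> {}" "subset.chain ?extensions C" for C
    proof -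
      have "partial_order_on A (\<Union>C)"
        using that by (intro partial_order_on_Union_chain) (auto simp: subset_chain_def chain_subset_def)
      moreover have "p \<subseteq> \<Union>C"
        using that by (fastforce simp: subset_chain_def)
      ultimately show ?thesis
        by blast
    qed
  qed
  then obtain r where "partial_order_on A r" "p \<subseteq> r"
    and "\<And>s. partial_order_on A s \<Longrightarrow> r \<subseteq> s \<Longrightarrow> s = r"
    by auto
  then show thesis
    using linear_order_on_if_maximal_partial_order_on that by blast
qed

section \<open>Topological order of the strong components\<close>

context wf_digraph
begin

lemma partition_on_sccs_verts: "partition_on (verts G) sccs_verts"
proof (rule partition_onI)
  show "\<Union>sccs_verts = verts G"
    using sccs_verts_subsets by (auto simp: sccs_verts_conv_scc_of intro: in_scc_of_self)
  show "disjnt S T" if "S \<in> sccs_verts" "T \<in> sccs_verts" "S \<noteq> T" for S T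
    using sccs_verts_disjoint that by (simp add: disjnt_def)
  show "{} \<notin> sccs_verts"
    by (simp add: in_sccs_verts_conv_reachable)
qed

lemma partial_order_on_reachable:
  assumes "\<Gamma> \<subseteq> verts G" and "inj_on scc_of \<Gamma>"
  shows "partial_order_on \<Gamma> {(x, y) \<in> \<Gamma> \<times> \<Gamma>. x \<rightarrow>\<^sup>* y}" (is "partial_order_on \<Gamma> ?r")
proof -
  have "refl_on \<Gamma> ?r"
    using assms(1) by (auto simp: refl_on_def)
  moreover have "trans ?r"
    by (rule transI) (auto intro: reachable_trans)
  moreover have "antisym ?r"
  proof (rule antisymI)
    fix x y assume "(x, y) \<in> ?r" "(y, x) \<in> ?r"
    then have "x \<in> \<Gamma>" "y \<in> \<Gamma>" "x \<in> scc_of y"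
      by (auto simp: scc_of_def)
    then show "x = y"
      using scc_of_eq inj_onD[OF assms(2)] by blast
  qed
  ultimately show ?thesis
    by (auto simp: order_on_defs)
qed

theorem sccs_topological_order:
  obtains \<Gamma> r where "linear_order_on \<Gamma> r" "inj_on scc_of \<Gamma>" "scc_of ` \<Gamma> = sccs_verts"
    and "\<And>x y u v. \<lbrakk>(x, y) \<in> r; x \<noteq> y; u \<in> scc_of y; v \<in> scc_of x\<rbrakk> \<Longrightarrow> \<not> u \<rightarrow>\<^sup>* v"
proof -
  obtain \<Gamma> where \<Gamma>: "\<Gamma> \<subseteq> verts G" "inj_on scc_of \<Gamma>" "sccs_verts = scc_of ` \<Gamma>"
    using subset_image_inj[of sccs_verts scc_of "verts G"] by (auto simp: sccs_verts_conv_scc_of)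
  obtain r where r: "linear_order_on \<Gamma> r" "{(x, y) \<in> \<Gamma> \<times> \<Gamma>. x \<rightarrow>\<^sup>* y} \<subseteq> r"
    using szpilrajn[OF partial_order_on_reachable[OF \<Gamma>(1,2)]] .
  have "\<not> u \<rightarrow>\<^sup>* v" if "(x, y) \<in> r" "x \<noteq> y" "u \<in> scc_of y" "v \<in> scc_of x" for x y u v
  proof
    assume "u \<rightarrow>\<^sup>* v"
    then have "y \<rightarrow>\<^sup>* x"
      using that(3,4) by (auto simp: scc_of_def intro: reachable_trans)
    then have "(y, x) \<in> r"
      using that(1) r by (auto simp: order_on_defs)
    then show False
      using that(1,2) r(1) by (auto simp: order_on_defs dest: antisymD)
  qed
  then show thesis
    using that \<Gamma>(2,3) r(1) by blast
qed

end

section \<open>Inclusion up to fewer than \<open>\<kappa>\<close> elements\<close>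

lemma finite_ordLess_Cinfinite:
  assumes "finite A" "Cinfinite \<kappa>"
  shows "|A| <o \<kappa>"
  using Cfinite_ordLess_Cinfinite[of "|A|" \<kappa>] assms card_of_Card_order[of A]
  by (simp add: cfinite_def Field_card_of)

definition almost_subset :: "'k rel \<Rightarrow> 'a set \<Rightarrow> 'a set \<Rightarrow> bool" where
  "almost_subset \<kappa> A B \<longleftrightarrow> |A - B| <o \<kappa>"

lemma almost_subset_if_Diff_subset_Un:
  assumes "Cinfinite \<kappa>" "|X| <o \<kappa>" "|Y| <o \<kappa>" "A - B \<subseteq> X \<union> Y"
  shows "almost_subset \<kappa> A B"
  unfolding almost_subset_def
  using card_of_mono1[OF assms(4)] Un_Cinfinite_bound_strict[OF assms(2,3,1)]
  by (rule ordLeq_ordLess_trans)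

lemma almost_subset_refl: "Cinfinite \<kappa> \<Longrightarrow> almost_subset \<kappa> A A"
  by (simp add: almost_subset_def finite_ordLess_Cinfinite)

lemma almost_subset_trans:
  assumes "Cinfinite \<kappa>" "almost_subset \<kappa> A B" "almost_subset \<kappa> B C"
  shows "almost_subset \<kappa> A C"
  using assms(2,3) unfolding almost_subset_def[of \<kappa> A B] almost_subset_def[of \<kappa> B C]
  by (rule almost_subset_if_Diff_subset_Un[OF assms(1)]) blast

lemma sym_diff_ordLess_if_almost_subset:
  assumes "Cinfinite \<kappa>" "almost_subset \<kappa> A B" "almost_subset \<kappa> B A"
  shows "|sym_diff A B \<inter> C| <o \<kappa>"
proof (rule ordLeq_ordLess_trans)
  show "|sym_diff A B \<inter> C| \<le>o |sym_diff A B|"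
    by (intro card_of_mono1) blast
  show "|sym_diff A B| <o \<kappa>"
    using assms by (simp add: almost_subset_def Un_Cinfinite_bound_strict)
qed

section \<open>Reversible arcs and neighbourhoods\<close>

context pair_loopfree_digraph
begin

lemma reversible_if_ordLeq_in_out_nbhd:
  assumes "Card_order \<kappa>" "u \<noteq> v" "\<kappa> \<le>o |in_nbhd G u \<inter> out_nbhd G v|"
  shows "reversible \<kappa> G u v"
proof -
  let ?path = "\<lambda>w. [(v, w), (w, u)]"
  have "|Field \<kappa>| \<le>o |in_nbhd G u \<inter> out_nbhd G v|"
    using card_of_Field_ordIso[OF assms(1)] assms(3) by (rule ordIso_ordLeq_trans)
  then obtain W where W: "W \<subseteq> in_nbhd G u \<inter> out_nbhd G v" "|Field \<kappa>| =o |W|"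
    using internalize_card_of_ordLeq2 by blast
  have arcs: "(v, w) \<in> parcs G" "(w, u) \<in> parcs G" if "w \<in> W" for w
    using W(1) that by (auto simp: in_nbhd_def out_nbhd_def)
  have "bij_betw ?path W (?path ` W)"
    by (simp add: bij_betw_def inj_on_def)
  then have "|Field \<kappa>| =o |?path ` W|"
    using W(2) card_of_ordIsoI ordIso_transitive by blast
  then have "|?path ` W| =o \<kappa>"
    by (rule ordIso_transitive[OF ordIso_symmetric card_of_Field_ordIso[OF assms(1)]])
  moreover have "apath v (?path w) u" if "w \<in> W" for w
    using arcs[OF that] assms(2) no_loops' in_arcsD1 in_arcsD2
    by (auto simp: apath_def awalk_def)
  moreover have "pairwise (\<lambda>p q. set p \<inter> set q = {}) (?path ` W)"
    using arcs no_loops' by (auto simp: pairwise_def)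
  ultimately show ?thesis
    unfolding reversible_def by blast
qed

lemma in_out_nbhd_ordLess_if_not_reversible:
  assumes "Card_order \<kappa>" "u \<noteq> v" "\<not> reversible \<kappa> G u v"
  shows "|in_nbhd G u \<inter> out_nbhd G v| <o \<kappa>"
proof -
  have "\<not> \<kappa> \<le>o |in_nbhd G u \<inter> out_nbhd G v|"
    using assms reversible_if_ordLeq_in_out_nbhd by blast
  then show ?thesis
    using assms(1) by (simp add: not_ordLeq_iff_ordLess card_of_Well_order card_order_on_well_order_on)
qed

end

definition nonreversible_subgraph :: "'k rel \<Rightarrow> 'a pair_pre_digraph \<Rightarrow> 'a pair_pre_digraph" where
  "nonreversible_subgraph \<kappa> D =
    \<lparr>pverts = pverts D, parcs = {(u, v) \<in> parcs D. \<not> reversible \<kappa> D u v}\<rparr>"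

lemma pverts_nonreversible_subgraph [simp]: "pverts (nonreversible_subgraph \<kappa> D) = pverts D"
  by (simp add: nonreversible_subgraph_def)

lemma in_parcs_nonreversible_subgraph [simp]:
  "(u, v) \<in> parcs (nonreversible_subgraph \<kappa> D) \<longleftrightarrow> (u, v) \<in> parcs D \<and> \<not> reversible \<kappa> D u v"
  by (simp add: nonreversible_subgraph_def)

lemma (in pair_wf_digraph) pair_wf_digraph_nonreversible_subgraph:
  "pair_wf_digraph (nonreversible_subgraph \<kappa> G)"
  by unfold_locales (auto dest: in_arcsD1 in_arcsD2)

lemma (in pair_wf_digraph) in_nbhd_subset_pverts: "in_nbhd G v \<subseteq> pverts G"
  by (auto simp: in_nbhd_def dest: in_arcsD1)

context tournament
begin

lemma out_nbhd_eq:
  assumes "v \<in> pverts D"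
  shows "out_nbhd D v = pverts D - in_nbhd D v - {v}"
proof -
  have "(v, w) \<in> parcs D \<longleftrightarrow> w \<in> pverts D \<and> (w, v) \<notin> parcs D \<and> w \<noteq> v" for w
    using exactly_one_arc[OF assms, of w] in_arcsD2[of v w] no_loops'[of v w] by blast
  then show ?thesis
    unfolding in_nbhd_def out_nbhd_def with_proj_simps by blast
qed

lemma almost_subset_in_nbhd_if_not_reversible:
  assumes "Cinfinite \<kappa>" "(u, v) \<in> parcs D" "\<not> reversible \<kappa> D u v"
  shows "almost_subset \<kappa> (in_nbhd D u) (in_nbhd D v)"
proof (rule almost_subset_if_Diff_subset_Un[OF assms(1)])
  show "|in_nbhd D u \<inter> out_nbhd D v| <o \<kappa>"
    using assms by (intro in_out_nbhd_ordLess_if_not_reversible) (auto dest: no_loops')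
  show "|{v}| <o \<kappa>"
    using assms(1) by (simp add: finite_ordLess_Cinfinite)
  show "in_nbhd D u - in_nbhd D v \<subseteq> in_nbhd D u \<inter> out_nbhd D v \<union> {v}"
    using in_nbhd_subset_pverts[of u] by (auto simp: out_nbhd_eq[OF in_arcsD2[OF assms(2)]])
qed

lemma almost_subset_in_nbhd_if_reachable:
  assumes "Cinfinite \<kappa>" "u \<rightarrow>\<^sup>*\<^bsub>nonreversible_subgraph \<kappa> D\<^esub> v"
  shows "almost_subset \<kappa> (in_nbhd D u) (in_nbhd D v)"
proof -
  interpret H: pair_wf_digraph "nonreversible_subgraph \<kappa> D"
    by (rule pair_wf_digraph_nonreversible_subgraph)
  from assms(2) show ?thesis
  proof (induction rule: H.reachable_induct)
    case base
    show ?case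
      using assms(1) by (rule almost_subset_refl)
  next
    case (step v w)
    then have "almost_subset \<kappa> (in_nbhd D v) (in_nbhd D w)"
      using assms(1) by (intro almost_subset_in_nbhd_if_not_reversible) simp_all
    with assms(1) step.IH show ?case
      by (rule almost_subset_trans)
  qed
qed

lemma almost_subset_out_nbhd_if_in_nbhd:
  assumes "Cinfinite \<kappa>" "u \<in> pverts D" "v \<in> pverts D"
    and "almost_subset \<kappa> (in_nbhd D v) (in_nbhd D u)"
  shows "almost_subset \<kappa> (out_nbhd D u) (out_nbhd D v)"
proof (rule almost_subset_if_Diff_subset_Un[OF assms(1)])
  show "|in_nbhd D v - in_nbhd D u| <o \<kappa>"
    using assms(4) by (simp add: almost_subset_def)
  show "|{v}| <o \<kappa>"
    using assms(1) by (simp add: finite_ordLess_Cinfinite)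
  show "out_nbhd D u - out_nbhd D v \<subseteq> in_nbhd D v - in_nbhd D u \<union> {v}"
    using assms(2,3) by (auto simp: out_nbhd_eq)
qed

lemma uniform_on_if_almost_subset_in_nbhd:
  assumes "Cinfinite \<kappa>" "A \<subseteq> pverts D"
    and "\<And>u v. u \<in> A \<Longrightarrow> v \<in> A \<Longrightarrow> almost_subset \<kappa> (in_nbhd D u) (in_nbhd D v)"
  shows "uniform_on \<kappa> D A"
  unfolding uniform_on_def
proof (intro ballI conjI)
  fix u v assume uv: "u \<in> A" "v \<in> A"
  then show "|sym_diff (in_nbhd D u) (in_nbhd D v) \<inter> A| <o \<kappa>"
    using assms(1,3) by (intro sym_diff_ordLess_if_almost_subset)
  show "|sym_diff (out_nbhd D u) (out_nbhd D v) \<inter> A| <o \<kappa>"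
    using assms uv by (intro sym_diff_ordLess_if_almost_subset almost_subset_out_nbhd_if_in_nbhd) auto
qed

lemma uniform_on_scc_of_nonreversible_subgraph:
  assumes "Cinfinite \<kappa>"
  shows "uniform_on \<kappa> D (pre_digraph.scc_of (nonreversible_subgraph \<kappa> D) x)"
proof -
  interpret H: pair_wf_digraph "nonreversible_subgraph \<kappa> D"
    by (rule pair_wf_digraph_nonreversible_subgraph)
  show ?thesis
  proof (rule uniform_on_if_almost_subset_in_nbhd[OF assms])
    show "H.scc_of x \<subseteq> pverts D"
      by (auto simp: H.scc_of_def dest: H.reachable_in_verts(2))
    show "almost_subset \<kappa> (in_nbhd D u) (in_nbhd D v)" if "u \<in> H.scc_of x" "v \<in> H.scc_of x" for u v
      using that by (intro almost_subset_in_nbhd_if_reachable[OF assms])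
        (auto simp: H.scc_of_def intro: H.reachable_trans)
  qed
qed

end

theorem theorem4p1:
  fixes \<kappa> :: "'k rel" and D :: "'a pair_pre_digraph"
  assumes "Card_order \<kappa>" and "cinfinite \<kappa>"
    and "tournament D" and "|pverts D| =o \<kappa>"
  shows "\<exists>(\<Gamma> :: 'a set) r V.
    linear_order_on \<Gamma> r \<and>
    partition_on (pverts D) (V ` \<Gamma>) \<and> inj_on V \<Gamma> \<and>
    (\<forall>x\<in>\<Gamma>. uniform_on \<kappa> D (V x)) \<and>
    (\<forall>x\<in>\<Gamma>. \<forall>y\<in>\<Gamma>. \<forall>u\<in>V y. \<forall>v\<in>V x.
       (x, y) \<in> r \<and> x \<noteq> y \<and> (u, v) \<in> parcs D \<longrightarrow> reversible \<kappa> D u v)"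
proof -
  interpret tournament D by fact
  interpret H: pair_wf_digraph "nonreversible_subgraph \<kappa> D"
    by (rule pair_wf_digraph_nonreversible_subgraph)
  obtain \<Gamma> r where \<Gamma>: "linear_order_on \<Gamma> r" "inj_on H.scc_of \<Gamma>" "H.scc_of ` \<Gamma> = H.sccs_verts"
    and not_backward: "\<And>x y u v. \<lbrakk>(x, y) \<in> r; x \<noteq> y; u \<in> H.scc_of y; v \<in> H.scc_of x\<rbrakk>
      \<Longrightarrow> \<not> u \<rightarrow>\<^sup>*\<^bsub>nonreversible_subgraph \<kappa> D\<^esub> v"
    using H.sccs_topological_order by blast
  have "partition_on (pverts D) (H.scc_of ` \<Gamma>)"
    using H.partition_on_sccs_verts by (simp add: \<Gamma>(3))
  moreover have "uniform_on \<kappa> D (H.scc_of x)" for x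
    using assms(1,2) by (intro uniform_on_scc_of_nonreversible_subgraph) simp
  moreover have "reversible \<kappa> D u v"
    if "u \<in> H.scc_of y" "v \<in> H.scc_of x" "(x, y) \<in> r" "x \<noteq> y" "(u, v) \<in> parcs D" for x y u v
    using not_backward[OF that(3,4,1,2)] H.reachable_adjI[of u v] that(5) by auto
  ultimately show ?thesis
    using \<Gamma>(1,2) by (intro exI[of _ \<Gamma>] exI[of _ r] exI[of _ H.scc_of]) blast
qed

end
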